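(* Let $\Gamma$ be a connected, locally finite, accessible graph, and let $C,D\in\mathcal{C}_{\mathrm{opt}}$ be optimal cuts of $\Gamma$. Then $C$ and $D$ are nested.
   Context: Graphs are undirected, without loops and multiple edges. Cuts. For $C\subseteq V(\Gamma)$ write $\overline{C}=V(\Gamma)\setminus C$ and $\delta C=\{uv\in E(\Gamma): u\in C, v\in\overline{C}\}$. A cut is a subset $C\subseteq V(\Gamma)$ such that $C$ and $\overline{C}$ are non-empty and induce connected subgraphs, and $\delta C$ is finite. A $k$-cut is a cut with $|\delta C|\le k$. Cuts $C,D$ are nested if one of $C\subseteq D$, $C\subseteq\overline{D}$, $\overline{C}\subseteq D$, $\overline{C}\subseteq\overline{D}$ holds. A bi-infinite simple path $\alpha$ is a sequence $(v_i)_{i\in\mathbb{Z}}$ of pairwise distinct vertices with $v_iv_{i+1}\in E(\Gamma)$; $\alpha\cap C$ denotes the set of its vertices in $C$. Put $\mathcal{C}(\alpha)=\{C : C \text{ is a cut and } |\alpha\cap C|=\infty=|\alpha\cap\overline{C}|\}$ and $\mathcal{C}_{\min}(\alpha)=\{C\in\mathcal{C}(\alpha): |\delta C| \text{ is minimal in } \mathcal{C}(\alpha)\}$. $\Gamma$ is accessible if there is $k\in\mathbb{N}$ such that for every bi-infinite simple path $\alpha$ either $\mathcal{C}(\alpha)=\emptyset$ or $\mathcal{C}(\alpha)$ contains a $k$-cut. Optimal cuts. Fix such a $k$. For a cut $C$ let $m(C)$ be the (finite) number of $k$-cuts $D$ that are not nested with $C$. For a bi-infinite simple path $\alpha$ with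 $\mathcal{C}(\alpha)\neq\emptyset$ let $m_\alpha=\min\{m(C): C\in\mathcal{C}_{\min}(\alpha)\}$ and $\mathcal{C}_{\mathrm{opt}}(\alpha)=\{C\in\mathcal{C}_{\min}(\alpha): m(C)=m_\alpha\}$ (and $\mathcal{C}_{\mathrm{opt}}(\alpha)=\emptyset$ if $\mathcal{C}(\alpha)=\emptyset$). Then $\mathcal{C}_{\mathrm{opt}}=\bigcup_\alpha \mathcal{C}_{\mathrm{opt}}(\alpha)$ over all bi-infinite simple paths $\alpha$; its elements are called optimal cuts. *)

theory Defs
  imports Main
begin

text \<open>
  A (possibly infinite) graph is a vertex set \<open>V\<close> together with a set \<open>E\<close> of two-element
  subsets of \<open>V\<close>.  Thus edges are undirected and there are no loops or multiple edges.
\<close>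

definition simple_graph :: "'a set \<Rightarrow> 'a set set \<Rightarrow> bool" where
  "simple_graph V E \<longleftrightarrow> (\<forall>e\<in>E. e \<subseteq> V \<and> card e = 2)"

definition locally_finite :: "'a set \<Rightarrow> 'a set set \<Rightarrow> bool" where
  "locally_finite V E \<longleftrightarrow> (\<forall>v\<in>V. finite {e \<in> E. v \<in> e})"

definition induces_connected :: "'a set set \<Rightarrow> 'a set \<Rightarrow> bool" where
  "induces_connected E C \<longleftrightarrow>
     (\<forall>u\<in>C. \<forall>v\<in>C. (u, v) \<in> {(x, y). x \<in> C \<and> y \<in> C \<and> {x, y} \<in> E}\<^sup>*)"

definition connected_graph :: "'a set \<Rightarrow> 'a set set \<Rightarrow> bool" where
  "connected_graph V E \<longleftrightarrow> induces_connected E V"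

definition edge_boundary :: "'a set \<Rightarrow> 'a set set \<Rightarrow> 'a set \<Rightarrow> 'a set set" where
  "edge_boundary V E C = {{u, v} | u v. {u, v} \<in> E \<and> u \<in> C \<and> v \<in> V - C}"

definition is_cut :: "'a set \<Rightarrow> 'a set set \<Rightarrow> 'a set \<Rightarrow> bool" where
  "is_cut V E C \<longleftrightarrow>
     C \<subseteq> V \<and> C \<noteq> {} \<and> V - C \<noteq> {} \<and>
     induces_connected E C \<and> induces_connected E (V - C) \<and>
     finite (edge_boundary V E C)"

definition is_k_cut :: "'a set \<Rightarrow> 'a set set \<Rightarrow> nat \<Rightarrow> 'a set \<Rightarrow> bool" where
  "is_k_cut V E k C \<longleftrightarrow> is_cut V E C \<and> card (edge_boundary V E C) \<le> k"

definition nested :: "'a set \<Rightarrow> 'a set \<Rightarrow> 'a set \<Rightarrow> bool" where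
  "nested V C D \<longleftrightarrow> C \<subseteq> D \<or> C \<subseteq> V - D \<or> V - C \<subseteq> D \<or> V - C \<subseteq> V - D"

definition biinfinite_path :: "'a set \<Rightarrow> 'a set set \<Rightarrow> (int \<Rightarrow> 'a) \<Rightarrow> bool" where
  "biinfinite_path V E \<alpha> \<longleftrightarrow>
     inj \<alpha> \<and> range \<alpha> \<subseteq> V \<and> (\<forall>i. {\<alpha> i, \<alpha> (i + 1)} \<in> E)"

definition cuts_of :: "'a set \<Rightarrow> 'a set set \<Rightarrow> (int \<Rightarrow> 'a) \<Rightarrow> 'a set set" where
  "cuts_of V E \<alpha> =
     {C. is_cut V E C \<and> infinite (range \<alpha> \<inter> C) \<and> infinite (range \<alpha> \<inter> (V - C))}"

definition min_cuts_of :: "'a set \<Rightarrow> 'a set set \<Rightarrow> (int \<Rightarrow> 'a) \<Rightarrow> 'a set set" where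
  "min_cuts_of V E \<alpha> =
     {C \<in> cuts_of V E \<alpha>.
        \<forall>D\<in>cuts_of V E \<alpha>. card (edge_boundary V E C) \<le> card (edge_boundary V E D)}"

definition accessibility_bound :: "'a set \<Rightarrow> 'a set set \<Rightarrow> nat \<Rightarrow> bool" where
  "accessibility_bound V E k \<longleftrightarrow>
     (\<forall>\<alpha>. biinfinite_path V E \<alpha> \<longrightarrow>
        cuts_of V E \<alpha> = {} \<or> (\<exists>C\<in>cuts_of V E \<alpha>. is_k_cut V E k C))"

definition accessible :: "'a set \<Rightarrow> 'a set set \<Rightarrow> bool" where
  "accessible V E \<longleftrightarrow> (\<exists>k. accessibility_bound V E k)"

text \<open>
  In a connected graph \<open>V\<close>, \<open>E\<close> only finitely many \<open>k\<close>-cuts are not nested with a given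
  cut, so for cuts \<open>C\<close> the cardinality below is a genuine count.
\<close>

definition crossing_number :: "'a set \<Rightarrow> 'a set set \<Rightarrow> nat \<Rightarrow> 'a set \<Rightarrow> nat" where
  "crossing_number V E k C = card {D. is_k_cut V E k D \<and> \<not> nested V D C}"

text \<open>
  The infimum of a non-empty set of natural numbers is its minimum.  If \<open>cuts_of V E \<alpha>\<close> is
  empty, then so is \<open>opt_cuts_of V E k \<alpha>\<close>, and the value of the infimum is irrelevant.
\<close>

definition min_crossing_number ::
    "'a set \<Rightarrow> 'a set set \<Rightarrow> nat \<Rightarrow> (int \<Rightarrow> 'a) \<Rightarrow> nat" where
  "min_crossing_number V E k \<alpha> = Inf (crossing_number V E k ` min_cuts_of V E \<alpha>)"

definition opt_cuts_of :: "'a set \<Rightarrow> 'a set set \<Rightarrow> nat \<Rightarrow> (int \<Rightarrow> 'a) \<Rightarrow> 'a set set" where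
  "opt_cuts_of V E k \<alpha> =
     {C \<in> min_cuts_of V E \<alpha>. crossing_number V E k C = min_crossing_number V E k \<alpha>}"

definition optimal_cuts :: "'a set \<Rightarrow> 'a set set \<Rightarrow> nat \<Rightarrow> 'a set set" where
  "optimal_cuts V E k = (\<Union>\<alpha>\<in>{\<alpha>. biinfinite_path V E \<alpha>}. opt_cuts_of V E k \<alpha>)"

end

theory Submission
  imports Defs
begin

text \<open>
  Drop the connectedness condition from the cuts separating a path \<open>\<alpha>\<close>: among all vertex sets
  with finite boundary which meet \<open>\<alpha>\<close> infinitely often on both sides, those with the smallest
  boundary are automatically cuts, because a disconnected side could be split into two parts
  with smaller boundaries, one of which still separates \<open>\<alpha>\<close>.  If the optimal cuts \<open>C\<close> for \<open>\<alpha>\<close>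
  and \<open>D\<close> for \<open>\<beta>\<close> cross, submodularity of the boundary size on opposite corners therefore
  yields opposite corners which are minimal cuts for \<open>\<alpha>\<close> and \<open>\<beta>\<close>.  The sum of the crossing numbers
  of two opposite corners is smaller than that of \<open>C\<close> and \<open>D\<close>, which contradicts optimality.
\<close>

section \<open>Edge boundaries\<close>

definition adjacency :: "'a set set \<Rightarrow> 'a set \<Rightarrow> ('a \<times> 'a) set" where
  "adjacency E C = {(x, y). x \<in> C \<and> y \<in> C \<and> {x, y} \<in> E}"

lemma induces_connected_iff:
  "induces_connected E C \<longleftrightarrow> (\<forall>u\<in>C. \<forall>v\<in>C. (u, v) \<in> (adjacency E C)\<^sup>*)"
  by (simp add: induces_connected_def adjacency_def)

lemma adjacency_rtrancl_sym:
  "(x, y) \<in> (adjacency E C)\<^sup>* \<Longrightarrow> (y, x) \<in> (adjacency E C)\<^sup>*"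
proof -
  have "sym (adjacency E C)"
    by (auto simp: sym_def adjacency_def insert_commute)
  then show "(x, y) \<in> (adjacency E C)\<^sup>* \<Longrightarrow> (y, x) \<in> (adjacency E C)\<^sup>*"
    by (meson sym_rtrancl symD)
qed

lemma rtrancl_leaves_set:
  assumes "(u, v) \<in> R\<^sup>*" "u \<in> Y" "v \<notin> Y"
  shows "\<exists>a b. (a, b) \<in> R \<and> a \<in> Y \<and> b \<notin> Y"
  using assms by (induction rule: rtrancl_induct) auto

text \<open>A walk uses only finitely many steps. The finite \<open>Q\<close> stands for a fixed
  walk: a set separating its ends must split one of finitely many pairs, so families of cuts are
  covered by finite unions.\<close>

lemma rtrancl_finite_subrelation:
  assumes "(u, v) \<in> R\<^sup>*"
  obtains Q where "finite Q" "Q \<subseteq> R" "(u, v) \<in> Q\<^sup>*"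
proof -
  have "\<exists>Q. finite Q \<and> Q \<subseteq> R \<and> (u, v) \<in> Q\<^sup>*" using assms
  proof (induction rule: rtrancl_induct)
    case base
    then show ?case by (intro exI[of _ "{}"]) auto
  next
    case (step y z)
    then obtain Q where Q: "finite Q" "Q \<subseteq> R" "(u, y) \<in> Q\<^sup>*" by blast
    have "(u, y) \<in> (insert (y, z) Q)\<^sup>*"
      using Q(3) by (meson rtrancl_mono subset_insertI subsetD)
    then have "(u, z) \<in> (insert (y, z) Q)\<^sup>*"
      by (meson insertI1 rtrancl.rtrancl_into_rtrancl)
    then show ?case
      using Q step by (intro exI[of _ "insert (y, z) Q"]) auto
  qed
  then show thesis using that by blast
qed

lemma edge_boundaryI:
  "{u, v} \<in> E \<Longrightarrow> u \<in> C \<Longrightarrow> v \<in> V \<Longrightarrow> v \<notin> C \<Longrightarrow> {u, v} \<in> edge_boundary V E C"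
  unfolding edge_boundary_def by blast

lemma edge_boundaryE:
  assumes "e \<in> edge_boundary V E C"
  obtains u v where "e = {u, v}" "{u, v} \<in> E" "u \<in> C" "v \<in> V" "v \<notin> C"
  using assms unfolding edge_boundary_def by blast

text \<open>This form is symmetric in \<open>x\<close> and \<open>y\<close>, so membership in
  several boundaries can be settled by cases on where the two end points lie.\<close>

lemma pair_in_edge_boundary_iff:
  assumes "C \<subseteq> V"
  shows "{x, y} \<in> edge_boundary V E C \<longleftrightarrow>
    {x, y} \<in> E \<and> x \<in> V \<and> y \<in> V \<and> (x \<in> C \<longleftrightarrow> y \<notin> C)"
proof
  assume "{x, y} \<in> edge_boundary V E C"
  then show "{x, y} \<in> E \<and> x \<in> V \<and> y \<in> V \<and> (x \<in> C \<longleftrightarrow> y \<notin> C)"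
    using assms by (elim edge_boundaryE) (auto simp: doubleton_eq_iff insert_commute)
next
  assume *: "{x, y} \<in> E \<and> x \<in> V \<and> y \<in> V \<and> (x \<in> C \<longleftrightarrow> y \<notin> C)"
  then show "{x, y} \<in> edge_boundary V E C"
    using edge_boundaryI[of x y] edge_boundaryI[of y x] by (cases "x \<in> C") (auto simp: insert_commute)
qed

lemma edge_boundary_subset_iff:
  "edge_boundary V E C \<subseteq> A \<longleftrightarrow>
    (\<forall>u v. {u, v} \<in> E \<longrightarrow> u \<in> C \<longrightarrow> v \<in> V \<longrightarrow> v \<notin> C \<longrightarrow> {u, v} \<in> A)"
  unfolding edge_boundary_def by blast

lemma edge_boundary_compl:
  assumes "C \<subseteq> V"
  shows "edge_boundary V E (V - C) = edge_boundary V E C"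
  unfolding set_eq_iff
proof
  fix e
  show "e \<in> edge_boundary V E (V - C) \<longleftrightarrow> e \<in> edge_boundary V E C"
  proof (cases "\<exists>x y. e = {x, y}")
    case True
    then show ?thesis using assms by (auto simp: pair_in_edge_boundary_iff)
  next
    case False
    then show ?thesis by (auto elim!: edge_boundaryE)
  qed
qed

lemma edge_boundary_nonempty:
  assumes "connected_graph V E" "C \<subseteq> V" "C \<noteq> {}" "C \<noteq> V"
  shows "edge_boundary V E C \<noteq> {}"
proof -
  obtain u v where "u \<in> C" "v \<in> V" "v \<notin> C" using assms by blast
  moreover have "(u, v) \<in> (adjacency E V)\<^sup>*"
    using assms calculation by (auto simp: connected_graph_def induces_connected_iff)
  ultimately obtain a b where "(a, b) \<in> adjacency E V" "a \<in> C" "b \<notin> C"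
    using rtrancl_leaves_set[of u v _ C] by blast
  then have "{a, b} \<in> edge_boundary V E C"
    by (auto simp: adjacency_def intro: edge_boundaryI)
  then show ?thesis by blast
qed

text \<open>An edge leaving one of the corners changes sides of \<open>C\<close> or of
  \<open>D\<close>. An edge in both corner boundaries joins the two corners, hence changes sides of
  both. Comparing unions and intersections gives submodularity.\<close>

lemma opposite_corners_boundary:
  fixes V E C D
  defines "E1 \<equiv> edge_boundary V E (C \<inter> D)"
    and "E2 \<equiv> edge_boundary V E ((V - C) \<inter> (V - D))"
  assumes "C \<subseteq> V" "D \<subseteq> V"
    and fin: "finite (edge_boundary V E C)" "finite (edge_boundary V E D)"
  shows "finite E1" "finite E2"
    and "card E1 + card E2 \<le> card (edge_boundary V E C) + card (edge_boundary V E D)"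
proof -
  have un: "E1 \<union> E2 \<subseteq> edge_boundary V E C \<union> edge_boundary V E D"
    using assms unfolding E1_def E2_def
    by (auto simp: edge_boundary_subset_iff pair_in_edge_boundary_iff)
  have int: "E1 \<inter> E2 \<subseteq> edge_boundary V E C \<inter> edge_boundary V E D"
  proof
    fix e assume e: "e \<in> E1 \<inter> E2"
    then obtain x y where "e = {x, y}" unfolding E1_def by (auto elim!: edge_boundaryE)
    moreover have "(V - C) \<inter> (V - D) \<subseteq> V" "C \<inter> D \<subseteq> V" using assms by auto
    ultimately show "e \<in> edge_boundary V E C \<inter> edge_boundary V E D"
      using e assms unfolding E1_def E2_def by (auto simp: pair_in_edge_boundary_iff)
  qed
  show f: "finite E1" "finite E2"
    using un fin by (meson finite_Un finite_subset)+
  have "card E1 + card E2 = card (E1 \<union> E2) + card (E1 \<inter> E2)"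
    using f by (rule card_Un_Int)
  also have "\<dots> \<le> card (edge_boundary V E C \<union> edge_boundary V E D)
      + card (edge_boundary V E C \<inter> edge_boundary V E D)"
    using un int fin by (intro add_mono card_mono) auto
  also have "\<dots> = card (edge_boundary V E C) + card (edge_boundary V E D)"
    using fin by (rule card_Un_Int[symmetric])
  finally show "card E1 + card E2 \<le> card (edge_boundary V E C) + card (edge_boundary V E D)" .
qed

section \<open>Separating sets\<close>

text \<open>Corners of crossing cuts need not induce connected subgraphs, so they are first tested
  against this weaker notion. Non-empty sides follow from the infinite intersections.\<close>

definition separators :: "'a set \<Rightarrow> 'a set set \<Rightarrow> (int \<Rightarrow> 'a) \<Rightarrow> 'a set set" where
  "separators V E \<alpha> = {X. X \<subseteq> V \<and> finite (edge_boundary V E X) \<and>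
     infinite (range \<alpha> \<inter> X) \<and> infinite (range \<alpha> \<inter> (V - X))}"

lemma cuts_of_subset_separators: "cuts_of V E \<alpha> \<subseteq> separators V E \<alpha>"
  by (auto simp: cuts_of_def separators_def is_cut_def)

lemma separators_compl:
  "X \<in> separators V E \<alpha> \<Longrightarrow> V - X \<in> separators V E \<alpha>"
  by (auto simp: separators_def edge_boundary_compl double_diff)

text \<open>If \<open>X\<close> splits into parts without edges between them, the boundaries of the
  parts are disjoint subsets of the boundary of \<open>X\<close>. Both are non-empty because the
  whole graph is connected, so each is strictly smaller.\<close>

lemma minimal_separator_connected:
  assumes conn: "connected_graph V E" and X: "X \<in> separators V E \<alpha>"
    and min: "\<And>Y. Y \<in> separators V E \<alpha> \<Longrightarrow>
      card (edge_boundary V E X) \<le> card (edge_boundary V E Y)"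
  shows "induces_connected E X"
proof (rule ccontr)
  assume "\<not> induces_connected E X"
  then obtain u v where uv: "u \<in> X" "v \<in> X" "(u, v) \<notin> (adjacency E X)\<^sup>*"
    by (auto simp: induces_connected_iff)
  \<comment> \<open>\<open>Y\<close> is the component of \<open>u\<close> in the subgraph induced by
    \<open>X\<close>; the rest \<open>Z\<close> contains \<open>v\<close>.\<close>
  define Y where "Y = {w \<in> X. (u, w) \<in> (adjacency E X)\<^sup>*}"
  define Z where "Z = X - Y"
  have XV: "X \<subseteq> V" and fin: "finite (edge_boundary V E X)"
    and inf: "infinite (range \<alpha> \<inter> X)" "infinite (range \<alpha> \<inter> (V - X))"
    using X by (auto simp: separators_def)
  have YZ: "X = Y \<union> Z" "Y \<inter> Z = {}" "u \<in> Y" "v \<in> Z"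
    using uv by (auto simp: Y_def Z_def)
  have no_edge: "{y, z} \<notin> E" if "y \<in> Y" "z \<in> Z" for y z
  proof
    assume "{y, z} \<in> E"
    then have "(y, z) \<in> adjacency E X" using that YZ by (auto simp: adjacency_def)
    moreover have "(u, y) \<in> (adjacency E X)\<^sup>*" "z \<in> X"
      using that by (auto simp: Y_def Z_def)
    ultimately have "z \<in> Y" by (simp add: Y_def)
    then show False using that YZ by blast
  qed
  have sub: "edge_boundary V E Y \<union> edge_boundary V E Z \<subseteq> edge_boundary V E X"
  proof -
    have "{z, y} \<notin> E" if "y \<in> Y" "z \<in> Z" for y z
      using no_edge[OF that] by (simp add: insert_commute)
    then have "edge_boundary V E Y \<subseteq> edge_boundary V E X" "edge_boundary V E Z \<subseteq> edge_boundary V E X"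
      unfolding edge_boundary_subset_iff using no_edge YZ(1) by (blast intro: edge_boundaryI)+
    then show ?thesis by blast
  qed
  have disj: "edge_boundary V E Y \<inter> edge_boundary V E Z = {}"
  proof (rule equals0I)
    fix e assume e: "e \<in> edge_boundary V E Y \<inter> edge_boundary V E Z"
    then obtain a b where "e = {a, b}" "{a, b} \<in> E" "a \<in> Y" "b \<notin> Y"
      by (auto elim!: edge_boundaryE)
    moreover have "Z \<subseteq> V" using YZ XV by blast
    ultimately show False
      using e no_edge YZ by (auto simp: pair_in_edge_boundary_iff)
  qed
  have finYZ: "finite (edge_boundary V E Y)" "finite (edge_boundary V E Z)"
    using sub fin by (meson finite_Un finite_subset)+
  have "V - X \<noteq> {}" using inf(2) by (metis Int_empty_right finite.emptyI)
  then have ne: "edge_boundary V E Y \<noteq> {}" "edge_boundary V E Z \<noteq> {}"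
    using YZ XV uv by (intro edge_boundary_nonempty[OF conn]; blast)+
  have "card (edge_boundary V E Y) + card (edge_boundary V E Z) \<le> card (edge_boundary V E X)"
    using card_mono[OF fin sub] disj finYZ by (simp add: card_Un_disjoint)
  moreover have "card (edge_boundary V E Y) > 0" "card (edge_boundary V E Z) > 0"
    using ne finYZ by (auto simp: card_gt_0_iff)
  ultimately have less: "card (edge_boundary V E Y) < card (edge_boundary V E X)"
      "card (edge_boundary V E Z) < card (edge_boundary V E X)"
    by linarith+
  have "infinite (range \<alpha> \<inter> Y) \<or> infinite (range \<alpha> \<inter> Z)"
    using inf(1) YZ(1) by (simp add: Int_Un_distrib)
  moreover have "infinite (range \<alpha> \<inter> (V - Y))" "infinite (range \<alpha> \<inter> (V - Z))"
    using inf(2) YZ(1) by (metis (no_types, lifting) Diff_mono Int_mono infinite_super subset_refl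
        sup_ge1 sup_ge2)+
  ultimately have "Y \<in> separators V E \<alpha> \<or> Z \<in> separators V E \<alpha>"
    using finYZ XV YZ(1) by (auto simp: separators_def)
  then show False using min less by (meson not_le)
qed

text \<open>The complement of \<open>X\<close> is a separator with the same boundary, hence also
  minimal, and so both sides are connected.\<close>

lemma minimal_separator_in_cuts_of:
  assumes conn: "connected_graph V E" and X: "X \<in> separators V E \<alpha>"
    and min: "\<And>Y. Y \<in> separators V E \<alpha> \<Longrightarrow>
      card (edge_boundary V E X) \<le> card (edge_boundary V E Y)"
  shows "X \<in> cuts_of V E \<alpha>"
proof -
  have "X \<subseteq> V" using X by (simp add: separators_def)
  then have "induces_connected E (V - X)"
    using min by (intro minimal_separator_connected[OF conn separators_compl[OF X]])
      (simp add: edge_boundary_compl)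
  moreover have "induces_connected E X"
    using minimal_separator_connected[OF conn X] min by blast
  moreover have "X \<noteq> {}" "V - X \<noteq> {}"
    using X unfolding separators_def by (metis (mono_tags, lifting) Int_empty_right finite.emptyI mem_Collect_eq)+
  ultimately show ?thesis
    using X by (simp add: separators_def cuts_of_def is_cut_def)
qed

text \<open>Minimality among cuts extends to minimality among separators: a separator whose boundary
  has the least size is itself a cut and competes with \<open>C\<close>.\<close>

lemma min_cuts_of_le_separator:
  assumes conn: "connected_graph V E" and C: "C \<in> min_cuts_of V E \<alpha>"
    and X: "X \<in> separators V E \<alpha>"
  shows "card (edge_boundary V E C) \<le> card (edge_boundary V E X)"
proof -
  obtain X' where X': "X' \<in> separators V E \<alpha>"
    "\<And>Y. Y \<in> separators V E \<alpha> \<Longrightarrow> card (edge_boundary V E X') \<le> card (edge_boundary V E Y)"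
    using exists_least_iff[of "\<lambda>n. \<exists>Y\<in>separators V E \<alpha>. card (edge_boundary V E Y) = n"] X
    by (metis not_le)
  then have "card (edge_boundary V E C) \<le> card (edge_boundary V E X')"
    using C minimal_separator_in_cuts_of[OF conn] by (auto simp: min_cuts_of_def)
  then show ?thesis using X'(2)[OF X] by linarith
qed

lemma separator_in_min_cuts_of:
  assumes conn: "connected_graph V E" and C: "C \<in> min_cuts_of V E \<alpha>"
    and X: "X \<in> separators V E \<alpha>"
    and le: "card (edge_boundary V E X) \<le> card (edge_boundary V E C)"
  shows "X \<in> min_cuts_of V E \<alpha>"
proof -
  have min: "card (edge_boundary V E X) \<le> card (edge_boundary V E Y)"
    if "Y \<in> separators V E \<alpha>" for Y
    using min_cuts_of_le_separator[OF conn C that] le by linarith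
  then show ?thesis
    using minimal_separator_in_cuts_of[OF conn X] cuts_of_subset_separators
    unfolding min_cuts_of_def by blast
qed

section \<open>Finiteness of crossing numbers\<close>

text \<open>Applied to both sides of a cut when an edge of its boundary is deleted: no walk inside a
  side uses that edge.\<close>

lemma induces_connected_delete_edge:
  assumes "induces_connected E C" "\<not> e \<subseteq> C"
  shows "induces_connected (E - {e}) C"
proof -
  have "adjacency (E - {e}) C = adjacency E C"
    using assms(2) by (auto simp: adjacency_def)
  then show ?thesis using assms(1) by (simp add: induces_connected_iff)
qed

lemma induces_connected_subset_component:
  assumes "induces_connected E F" "F \<subseteq> V" "x \<in> F"
  shows "F \<subseteq> {w. (x, w) \<in> (adjacency E V)\<^sup>*}"
proof
  fix w assume "w \<in> F"
  then have "(x, w) \<in> (adjacency E F)\<^sup>*"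
    using assms by (auto simp: induces_connected_iff)
  moreover have "adjacency E F \<subseteq> adjacency E V"
    using assms by (auto simp: adjacency_def)
  ultimately show "w \<in> {w. (x, w) \<in> (adjacency E V)\<^sup>*}"
    using rtrancl_mono by blast
qed

text \<open>
  Induction on \<open>k\<close>: if \<open>{x, y}\<close> is a bridge, the cut is a component of the graph without this edge.
  Otherwise the cut becomes a smaller one after deleting \<open>{x, y}\<close>, and its boundary
  contains an edge of any fixed path from \<open>x\<close> to \<open>y\<close> in the remaining graph.
\<close>
lemma finite_k_cuts_through_edge:
  assumes "connected_graph V E"
  shows "finite {F. is_k_cut V E k F \<and> {x, y} \<in> edge_boundary V E F}"
  using assms
proof (induction k arbitrary: E x y)
  case 0
  \<comment> \<open>A finite boundary of size at most 0 cannot contain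
    \<open>{x, y}\<close>.\<close>
  have "{F. is_k_cut V E 0 F \<and> {x, y} \<in> edge_boundary V E F} = {}"
    by (auto simp: is_k_cut_def is_cut_def)
  then show ?case by (metis finite.emptyI)
next
  case (Suc k)
  define E' where "E' = E - {{x, y}}"
  define comp where "comp z = {w. (z, w) \<in> (adjacency E' V)\<^sup>*}" for z
  let ?A = "{F. is_k_cut V E (Suc k) F \<and> {x, y} \<in> edge_boundary V E F}"
  have cut: "F \<subseteq> V \<and> induces_connected E' F \<and> induces_connected E' (V - F) \<and>
      x \<in> V \<and> y \<in> V \<and> (x \<in> F \<longleftrightarrow> y \<notin> F)" if "F \<in> ?A" for F
  proof -
    have F: "F \<subseteq> V" "induces_connected E F" "induces_connected E (V - F)"
      using that by (auto simp: is_k_cut_def is_cut_def)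
    then have "x \<in> V \<and> y \<in> V \<and> (x \<in> F \<longleftrightarrow> y \<notin> F)"
      using that by (auto simp: pair_in_edge_boundary_iff)
    then show ?thesis
      using F induces_connected_delete_edge[of E _ "{x, y}"] unfolding E'_def by auto
  qed
  \<comment> \<open>Each side of \<open>F\<close> contains exactly one of \<open>x\<close> and
    \<open>y\<close> and stays connected without the edge, so it lies in the component of that end
    point.\<close>
  have comps: "V \<subseteq> comp x \<union> comp y" "F \<subseteq> comp x \<and> V - F \<subseteq> comp y \<or> F \<subseteq> comp y \<and> V - F \<subseteq> comp x"
    if "F \<in> ?A" for F
  proof -
    show "F \<subseteq> comp x \<and> V - F \<subseteq> comp y \<or> F \<subseteq> comp y \<and> V - F \<subseteq> comp x"
      using cut[OF that] induces_connected_subset_component[of E' F V]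
        induces_connected_subset_component[of E' "V - F" V] unfolding comp_def
      by (cases "x \<in> F") auto
    then show "V \<subseteq> comp x \<union> comp y" by blast
  qed
  show ?case
  proof (cases "(x, y) \<in> (adjacency E' V)\<^sup>*")
    case False
    have disj: "comp x \<inter> comp y = {}"
      using False adjacency_rtrancl_sym[of y _ E' V] unfolding comp_def
      by (auto dest: rtrancl_trans)
    have "?A \<subseteq> {V \<inter> comp x, V \<inter> comp y}"
    proof
      fix F assume "F \<in> ?A"
      then show "F \<in> {V \<inter> comp x, V \<inter> comp y}"
        using comps(2)[of F] cut[of F] disj by blast
    qed
    then show ?thesis by (rule finite_subset) simp
  next
    case True
    show ?thesis
    \<comment> \<open>A single cut in \<open>?A\<close> shows that the components of
      \<open>x\<close> and \<open>y\<close> cover \<open>V\<close>. As \<open>y\<close> is reachable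
      from \<open>x\<close>, the graph \<open>E'\<close> is then connected and the induction
      hypothesis applies.\<close>
    proof (cases "?A = {}")
      case False
      then have "V \<subseteq> comp x \<union> comp y" using comps(1) by blast
      then have all: "(x, w) \<in> (adjacency E' V)\<^sup>*" if "w \<in> V" for w
        using that True unfolding comp_def by (auto dest: rtrancl_trans)
      have conn: "connected_graph V E'"
        unfolding connected_graph_def induces_connected_iff
        using all by (meson adjacency_rtrancl_sym rtrancl_trans)
      obtain Q where Q: "finite Q" "Q \<subseteq> adjacency E' V" "(x, y) \<in> Q\<^sup>*"
        using True by (rule rtrancl_finite_subrelation)
      have "?A \<subseteq> (\<Union>(a, b)\<in>Q. {F. is_k_cut V E' k F \<and> {a, b} \<in> edge_boundary V E' F})"
      proof
        fix F assume F: "F \<in> ?A"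
        \<comment> \<open>If \<open>y\<close> rather than \<open>x\<close> lies in \<open>F\<close>,
          the walk is followed backwards to find the step leaving \<open>F\<close>.\<close>
        have "(y, x) \<in> (Q\<inverse>)\<^sup>*" using Q(3) by (simp add: rtrancl_converse)
        then have "\<exists>a b. (a, b) \<in> Q \<and> (a \<in> F \<longleftrightarrow> b \<notin> F)"
          using cut[OF F] Q(3) rtrancl_leaves_set[of x y Q F] rtrancl_leaves_set[of y x "Q\<inverse>" F]
          by (cases "x \<in> F") auto
        then obtain a b where ab: "(a, b) \<in> Q" "a \<in> F \<longleftrightarrow> b \<notin> F" by blast
        have in_bd: "{a, b} \<in> edge_boundary V E' F"
          using ab Q(2) cut[OF F] by (auto simp: pair_in_edge_boundary_iff adjacency_def)
        have bd: "edge_boundary V E' F = edge_boundary V E F - {{x, y}}"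
          unfolding E'_def edge_boundary_def by blast
        have "card (edge_boundary V E' F) \<le> k" "finite (edge_boundary V E' F)"
          using F by (auto simp: bd is_k_cut_def is_cut_def card_Diff_singleton)
        then have "is_k_cut V E' k F"
          using F cut[OF F] by (auto simp: is_k_cut_def is_cut_def)
        then show "F \<in> (\<Union>(a, b)\<in>Q. {F. is_k_cut V E' k F \<and> {a, b} \<in> edge_boundary V E' F})"
          using ab in_bd by blast
      qed
      then show ?thesis
        by (rule finite_subset) (use Q(1) Suc.IH[OF conn] in auto)
    qed (metis finite.emptyI)
  qed
qed

lemma finite_k_cuts_separating:
  assumes "connected_graph V E" "s \<in> V" "t \<in> V"
  shows "finite {F. is_k_cut V E k F \<and> s \<in> F \<and> t \<notin> F}"
proof -
  have "(s, t) \<in> (adjacency E V)\<^sup>*"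
    using assms by (auto simp: connected_graph_def induces_connected_iff)
  then obtain Q where Q: "finite Q" "Q \<subseteq> adjacency E V" "(s, t) \<in> Q\<^sup>*"
    by (rule rtrancl_finite_subrelation)
  have "{F. is_k_cut V E k F \<and> s \<in> F \<and> t \<notin> F} \<subseteq>
      (\<Union>(a, b)\<in>Q. {F. is_k_cut V E k F \<and> {a, b} \<in> edge_boundary V E F})"
  proof
    fix F assume F: "F \<in> {F. is_k_cut V E k F \<and> s \<in> F \<and> t \<notin> F}"
    then obtain a b where ab: "(a, b) \<in> Q" "a \<in> F" "b \<notin> F"
      using rtrancl_leaves_set[OF Q(3), of F] by blast
    then have "{a, b} \<in> edge_boundary V E F"
      using Q(2) by (auto simp: adjacency_def intro!: edge_boundaryI)
    then show "F \<in> (\<Union>(a, b)\<in>Q. {F. is_k_cut V E k F \<and> {a, b} \<in> edge_boundary V E F})"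
      using ab F by blast
  qed
  then show ?thesis
    by (rule finite_subset) (use Q(1) finite_k_cuts_through_edge[OF assms(1)] in auto)
qed

lemma connected_meets_boundary:
  assumes "induces_connected E F" "F \<subseteq> V" "F \<inter> C \<noteq> {}" "F - C \<noteq> {}"
  obtains a b where "{a, b} \<in> edge_boundary V E C" "a \<in> F" "b \<in> F"
proof -
  obtain u v where "u \<in> F" "u \<in> C" "v \<in> F" "v \<notin> C" using assms by blast
  moreover have "(u, v) \<in> (adjacency E F)\<^sup>*"
    using assms calculation by (auto simp: induces_connected_iff)
  ultimately obtain a b where ab: "(a, b) \<in> adjacency E F" "a \<in> C" "b \<notin> C"
    using rtrancl_leaves_set[of u v _ C] by blast
  then have "{a, b} \<in> edge_boundary V E C"
    using assms(2) by (auto simp: adjacency_def intro!: edge_boundaryI)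
  then show thesis using that ab by (auto simp: adjacency_def)
qed

text \<open>
  Both sides of a cut \<open>F\<close> crossing \<open>C\<close> contain an edge of the boundary of \<open>C\<close>, so \<open>F\<close> separates
  two of the finitely many end points of these edges.
\<close>
lemma finite_crossing:
  assumes conn: "connected_graph V E" and C: "C \<subseteq> V" "finite (edge_boundary V E C)"
  shows "finite {F. is_k_cut V E k F \<and> \<not> nested V F C}"
proof -
  define S where "S = \<Union>(edge_boundary V E C)"
  have "S \<subseteq> V" using C(1) by (auto simp: S_def edge_boundary_def)
  have "finite S" unfolding S_def
    using C(2) by (auto elim!: edge_boundaryE)
  have "{F. is_k_cut V E k F \<and> \<not> nested V F C} \<subseteq>
      (\<Union>s\<in>S. \<Union>t\<in>S. {F. is_k_cut V E k F \<and> s \<in> F \<and> t \<notin> F})"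
  proof
    fix F assume F: "F \<in> {F. is_k_cut V E k F \<and> \<not> nested V F C}"
    then have FV: "F \<subseteq> V" and con: "induces_connected E F" "induces_connected E (V - F)"
      by (auto simp: is_k_cut_def is_cut_def)
    have ne: "F \<inter> C \<noteq> {}" "F - C \<noteq> {}" "(V - F) \<inter> C \<noteq> {}" "(V - F) - C \<noteq> {}"
      using F FV by (auto simp: nested_def)
    obtain a b where "{a, b} \<in> edge_boundary V E C" "a \<in> F"
      by (rule connected_meets_boundary[OF con(1) FV ne(1,2)])
    moreover obtain c d where "{c, d} \<in> edge_boundary V E C" "c \<in> V - F"
      by (rule connected_meets_boundary[OF con(2) Diff_subset ne(3,4)])
    ultimately have "a \<in> S" "c \<in> S" "a \<in> F" "c \<notin> F" by (auto simp: S_def)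
    then show "F \<in> (\<Union>s\<in>S. \<Union>t\<in>S. {F. is_k_cut V E k F \<and> s \<in> F \<and> t \<notin> F})"
      using F by blast
  qed
  then show ?thesis
    by (rule finite_subset)
      (use \<open>finite S\<close> \<open>S \<subseteq> V\<close> finite_k_cuts_separating[OF conn] in blast)
qed

section \<open>Crossing numbers of opposite corners\<close>

lemma nested_compl: "C \<subseteq> V \<Longrightarrow> nested V F (V - C) \<longleftrightarrow> nested V F C"
  by (auto simp: nested_def double_diff)

lemma nested_commute: "C \<subseteq> V \<Longrightarrow> D \<subseteq> V \<Longrightarrow> nested V C D \<longleftrightarrow> nested V D C"
  by (auto simp: nested_def)

text \<open>If a side of \<open>F\<close> lies in \<open>C\<close>, the other side contains the
  corner outside both sets; if it lies in \<open>V - C\<close>, the other side contains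
  \<open>C \<inter> D\<close>. The same holds for \<open>D\<close>. Contrapositively, a set crossing
  both corners crosses \<open>C\<close> and \<open>D\<close>.\<close>

lemma nested_corner_or:
  assumes "nested V F C \<or> nested V F D" "F \<subseteq> V" "C \<subseteq> V" "D \<subseteq> V"
  shows "nested V F (C \<inter> D) \<or> nested V F ((V - C) \<inter> (V - D))"
  using assms unfolding nested_def by (elim disjE) blast+

text \<open>Contrapositively, a set crossing one of the two corners crosses \<open>C\<close> or
  \<open>D\<close>. Together with \<open>nested_corner_or\<close> this gives the inclusions of
  unions and intersections needed for counting.\<close>

lemma nested_corner_and:
  assumes "nested V F C" "nested V F D" "F \<subseteq> V" "C \<subseteq> V" "D \<subseteq> V" "\<not> nested V C D"
  shows "nested V F (C \<inter> D)" "nested V F ((V - C) \<inter> (V - D))"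
proof -
  let ?P = "C \<inter> D" and ?Q = "(V - C) \<inter> (V - D)"
  have ne: "?P \<noteq> {}" "V - (C \<union> D) \<noteq> {}"
    using assms(4-6) by (auto simp: nested_def)
  have F: "F \<subseteq> C \<or> V - F \<subseteq> C \<or> F \<subseteq> V - C \<or> V - F \<subseteq> V - C"
    "F \<subseteq> D \<or> V - F \<subseteq> D \<or> F \<subseteq> V - D \<or> V - F \<subseteq> V - D"
    using assms(1,2) by (auto simp: nested_def)
  have *: "nested V F ?P"
    if "F \<subseteq> V - X \<or> V - F \<subseteq> V - X" "X = C \<or> X = D" for X
    using that \<open>F \<subseteq> V\<close> unfolding nested_def by auto
  \<comment> \<open>The mixed case, with one side of \<open>F\<close> in \<open>C\<close> and the
    other in \<open>D\<close>, would force \<open>C \<union> D = V\<close>, contrary to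
    \<open>ne\<close>.\<close>
  have "nested V F ?P"
    if "F \<subseteq> C \<or> V - F \<subseteq> C" "F \<subseteq> D \<or> V - F \<subseteq> D"
    using that ne \<open>F \<subseteq> V\<close> unfolding nested_def by auto
  then show "nested V F ?P" using * F by blast
  have **: "nested V F ?Q"
    if "F \<subseteq> X \<or> V - F \<subseteq> X" "X = C \<or> X = D" for X
    using that \<open>F \<subseteq> V\<close> unfolding nested_def by auto
  \<comment> \<open>Here the mixed case would make \<open>C \<inter> D\<close> empty.\<close>
  have "nested V F ?Q"
    if "F \<subseteq> V - C \<or> V - F \<subseteq> V - C" "F \<subseteq> V - D \<or> V - F \<subseteq> V - D"
    using that ne \<open>F \<subseteq> V\<close> \<open>C \<subseteq> V\<close> unfolding nested_def by auto
  then show "nested V F ?Q" using ** F by blast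
qed

lemma crossing_number_opposite_corners:
  assumes conn: "connected_graph V E" and C: "is_k_cut V E k C" and D: "is_k_cut V E k D"
    and cross: "\<not> nested V C D"
  shows "crossing_number V E k (C \<inter> D) + crossing_number V E k ((V - C) \<inter> (V - D))
    < crossing_number V E k C + crossing_number V E k D"
proof -
  define N where "N X = {F. is_k_cut V E k F \<and> \<not> nested V F X}" for X
  let ?P = "C \<inter> D" and ?Q = "(V - C) \<inter> (V - D)"
  have CV: "C \<subseteq> V" "finite (edge_boundary V E C)" and DV: "D \<subseteq> V" "finite (edge_boundary V E D)"
    using C D by (auto simp: is_k_cut_def is_cut_def)
  have fin: "finite (N C)" "finite (N D)"
    unfolding N_def using finite_crossing[OF conn CV] finite_crossing[OF conn DV] by auto
  have un: "N ?P \<union> N ?Q \<subseteq> N C \<union> N D"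
    using nested_corner_and[OF _ _ _ CV(1) DV(1) cross]
    by (auto simp: N_def is_k_cut_def is_cut_def)
  have int: "N ?P \<inter> N ?Q \<subseteq> N C \<inter> N D"
    using nested_corner_or[OF _ _ CV(1) DV(1)]
    by (auto simp: N_def is_k_cut_def is_cut_def)
  \<comment> \<open>Strictness comes from \<open>C\<close> itself: it is a \<open>k\<close>-cut
    crossing \<open>D\<close>, yet nested with both corners.\<close>
  have "C \<in> N D" using C cross by (simp add: N_def)
  moreover have "C \<notin> N ?P \<union> N ?Q" using CV(1) by (auto simp: N_def nested_def)
  ultimately have "card (N ?P \<union> N ?Q) < card (N C \<union> N D)"
    using un fin by (intro psubset_card_mono) auto
  moreover have "card (N ?P \<inter> N ?Q) \<le> card (N C \<inter> N D)"
    using int fin by (intro card_mono) auto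
  moreover have "card (N C) + card (N D) = card (N C \<union> N D) + card (N C \<inter> N D)"
    using fin by (rule card_Un_Int)
  moreover have "card (N ?P) + card (N ?Q) = card (N ?P \<union> N ?Q) + card (N ?P \<inter> N ?Q)"
    using un fin by (intro card_Un_Int) (meson finite_Un finite_subset)+
  ultimately have "card (N ?P) + card (N ?Q) < card (N C) + card (N D)"
    by linarith
  then show ?thesis by (simp add: crossing_number_def N_def)
qed

section \<open>Optimal cuts\<close>

lemma is_cut_compl: "is_cut V E C \<Longrightarrow> is_cut V E (V - C)"
  by (auto simp: is_cut_def double_diff edge_boundary_compl)

lemma min_cuts_of_compl:
  assumes "C \<in> min_cuts_of V E \<alpha>"
  shows "V - C \<in> min_cuts_of V E \<alpha>"
proof -
  have "C \<subseteq> V" using assms by (auto simp: min_cuts_of_def cuts_of_def is_cut_def)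
  then show ?thesis
    using assms is_cut_compl[of V E C]
    by (auto simp: min_cuts_of_def cuts_of_def edge_boundary_compl double_diff)
qed

lemma opt_cuts_of_compl:
  assumes "C \<in> opt_cuts_of V E k \<alpha>"
  shows "V - C \<in> opt_cuts_of V E k \<alpha>"
proof -
  have "C \<subseteq> V" using assms by (auto simp: opt_cuts_of_def min_cuts_of_def cuts_of_def is_cut_def)
  then have "crossing_number V E k (V - C) = crossing_number V E k C"
    by (simp add: crossing_number_def nested_compl)
  then show ?thesis
    using assms min_cuts_of_compl by (auto simp: opt_cuts_of_def)
qed

lemma opt_cuts_of_crossing_number_le:
  assumes "C \<in> opt_cuts_of V E k \<alpha>" "X \<in> min_cuts_of V E \<alpha>"
  shows "crossing_number V E k C \<le> crossing_number V E k X"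
  using assms by (auto simp: opt_cuts_of_def min_crossing_number_def intro!: cInf_lower)

text \<open>The boundary of \<open>C\<close> is no larger than that of the \<open>k\<close>-cut
  supplied by accessibility. Thus optimal cuts are themselves among the cuts that crossing numbers
  count.\<close>

lemma opt_cuts_of_is_k_cut:
  assumes "accessibility_bound V E k" "biinfinite_path V E \<alpha>" "C \<in> opt_cuts_of V E k \<alpha>"
  shows "is_k_cut V E k C"
proof -
  have C: "C \<in> cuts_of V E \<alpha>"
    "\<And>D. D \<in> cuts_of V E \<alpha> \<Longrightarrow> card (edge_boundary V E C) \<le> card (edge_boundary V E D)"
    using assms(3) by (auto simp: opt_cuts_of_def min_cuts_of_def)
  then obtain D where "D \<in> cuts_of V E \<alpha>" "is_k_cut V E k D"
    using assms by (auto simp: accessibility_bound_def)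
  then show ?thesis
    using C by (auto simp: is_k_cut_def cuts_of_def intro: order_trans)
qed

text \<open>Each corner boundary is at least as large as that of the cut minimal for the same path,
  so submodularity forces equality in both comparisons. Both corners are then minimal cuts, and
  their crossing numbers are too small in total.\<close>

lemma opposite_corners_not_separators:
  assumes conn: "connected_graph V E"
    and C: "C \<in> opt_cuts_of V E k \<alpha>" "is_k_cut V E k C"
    and D: "D \<in> opt_cuts_of V E k \<beta>" "is_k_cut V E k D"
    and cross: "\<not> nested V C D"
    and P: "C \<inter> D \<in> separators V E \<alpha>" and Q: "(V - C) \<inter> (V - D) \<in> separators V E \<beta>"
  shows False
proof -
  have sub: "C \<subseteq> V" "D \<subseteq> V" "finite (edge_boundary V E C)" "finite (edge_boundary V E D)"
    using C D by (auto simp: is_k_cut_def is_cut_def)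
  have min: "C \<in> min_cuts_of V E \<alpha>" "D \<in> min_cuts_of V E \<beta>"
    using C D by (auto simp: opt_cuts_of_def)
  note opposite_corners_boundary(3)[OF sub]
  then have "C \<inter> D \<in> min_cuts_of V E \<alpha>" "(V - C) \<inter> (V - D) \<in> min_cuts_of V E \<beta>"
    using separator_in_min_cuts_of[OF conn min(1) P] separator_in_min_cuts_of[OF conn min(2) Q]
      min_cuts_of_le_separator[OF conn min(1) P] min_cuts_of_le_separator[OF conn min(2) Q]
    by linarith+
  then show False
    using opt_cuts_of_crossing_number_le[OF C(1)] opt_cuts_of_crossing_number_le[OF D(1)]
      crossing_number_opposite_corners[OF conn C(2) D(2) cross]
    by (meson add_mono not_le)
qed

text \<open>The optimal cut \<open>B\<close> is kept apart from \<open>C\<close> because on the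
  second diagonal \<open>C\<close> is only known to be minimal for the path, while the optimal cut
  is \<open>D\<close>.\<close>

lemma corners_crossing_number_ge:
  assumes conn: "connected_graph V E"
    and C: "C \<in> min_cuts_of V E \<alpha>" and CD: "C \<subseteq> V" "D \<subseteq> V"
      "finite (edge_boundary V E C)" "finite (edge_boundary V E D)"
    and eq: "card (edge_boundary V E D) = card (edge_boundary V E C)"
    and P: "C \<inter> D \<in> separators V E \<alpha>" and Q: "(V - C) \<inter> (V - D) \<in> separators V E \<alpha>"
    and B: "B \<in> opt_cuts_of V E k \<alpha>"
  shows "2 * crossing_number V E k B \<le>
    crossing_number V E k (C \<inter> D) + crossing_number V E k ((V - C) \<inter> (V - D))"
proof -
  have "C \<inter> D \<in> min_cuts_of V E \<alpha>" "(V - C) \<inter> (V - D) \<in> min_cuts_of V E \<alpha>"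
    using separator_in_min_cuts_of[OF conn C P] separator_in_min_cuts_of[OF conn C Q]
      min_cuts_of_le_separator[OF conn C P] min_cuts_of_le_separator[OF conn C Q]
      opposite_corners_boundary(3)[OF CD] eq
    by linarith+
  then show ?thesis
    using opt_cuts_of_crossing_number_le[OF B] by (metis add_mono mult_2)
qed

text \<open>
  If \<open>\<alpha>\<close> runs between one pair of opposite corners and \<open>\<beta>\<close> between the other, then \<open>C\<close> and \<open>D\<close> each
  separate both paths, so their boundaries have equal size and all four corners are minimal.
\<close>
lemma not_separated_by_both_diagonals:
  assumes conn: "connected_graph V E"
    and C: "C \<in> opt_cuts_of V E k \<alpha>" "is_k_cut V E k C"
    and D: "D \<in> opt_cuts_of V E k \<beta>" "is_k_cut V E k D"
    and cross: "\<not> nested V C D"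
    and \<alpha>: "C \<inter> D \<in> separators V E \<alpha>" "(V - C) \<inter> (V - D) \<in> separators V E \<alpha>"
    and \<beta>: "C \<inter> (V - D) \<in> separators V E \<beta>" "(V - C) \<inter> D \<in> separators V E \<beta>"
  shows False
proof -
  have sub: "C \<subseteq> V" "D \<subseteq> V" "finite (edge_boundary V E C)" "finite (edge_boundary V E D)"
    using C D by (auto simp: is_k_cut_def is_cut_def)
  have VD: "V - (V - D) = D" "V - D \<subseteq> V" "edge_boundary V E (V - D) = edge_boundary V E D"
    using sub by (auto simp: edge_boundary_compl)
  have cross': "\<not> nested V C (V - D)"
    using cross sub by (simp add: nested_compl)
  have kD: "is_k_cut V E k (V - D)"
    using D(2) is_cut_compl[of V E D] VD(3) by (simp add: is_k_cut_def)
  have min: "C \<in> min_cuts_of V E \<alpha>" "D \<in> min_cuts_of V E \<beta>"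
    using C D by (auto simp: opt_cuts_of_def)
  have sup: "infinite (range \<gamma> \<inter> Y)" if "X \<in> separators V E \<gamma>" "X \<subseteq> Y" for X Y \<gamma>
    using that infinite_super[of "range \<gamma> \<inter> X" "range \<gamma> \<inter> Y"] by (auto simp: separators_def)
  have "D \<in> separators V E \<alpha>"
    using sub sup[OF \<alpha>(1), of D] sup[OF \<alpha>(2), of "V - D"] by (simp add: separators_def)
  moreover have "C \<in> separators V E \<beta>"
    using sub sup[OF \<beta>(1), of C] sup[OF \<beta>(2), of "V - C"] by (simp add: separators_def)
  ultimately have eq: "card (edge_boundary V E D) = card (edge_boundary V E C)"
    using min_cuts_of_le_separator[OF conn] min by (metis antisym)
  have C\<beta>: "C \<in> min_cuts_of V E \<beta>"
    using separator_in_min_cuts_of[OF conn min(2) \<open>C \<in> separators V E \<beta>\<close>] eq by simp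
  have "2 * crossing_number V E k C \<le>
      crossing_number V E k (C \<inter> D) + crossing_number V E k ((V - C) \<inter> (V - D))"
    by (rule corners_crossing_number_ge[OF conn min(1) sub eq \<alpha> C(1)])
  moreover have "2 * crossing_number V E k D \<le>
      crossing_number V E k (C \<inter> (V - D)) + crossing_number V E k ((V - C) \<inter> D)"
    using corners_crossing_number_ge[OF conn C\<beta> sub(1) VD(2) sub(3)] eq \<beta> D(1) sub VD by simp
  moreover have "crossing_number V E k (V - D) = crossing_number V E k D"
    using sub by (simp add: crossing_number_def nested_compl)
  \<comment> \<open>The first diagonal makes the crossing number of \<open>C\<close> smaller than
    that of \<open>D\<close>, and the second gives the reverse inequality.\<close>
  ultimately show False
    using crossing_number_opposite_corners[OF conn C(2) D(2) cross]
      crossing_number_opposite_corners[OF conn C(2) kD cross'] VD(1) by simp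
qed

theorem proposition3p7:
  fixes V :: "'a set" and E :: "'a set set" and k :: nat and C D :: "'a set"
  assumes "simple_graph V E"
    and "connected_graph V E"
    and "locally_finite V E"
    and "accessible V E"
    and "accessibility_bound V E k"
    and "C \<in> optimal_cuts V E k"
    and "D \<in> optimal_cuts V E k"
  shows "nested V C D"
proof (rule ccontr)
  assume cross: "\<not> nested V C D"
  note conn = \<open>connected_graph V E\<close>
  obtain \<alpha> \<beta> where C: "C \<in> opt_cuts_of V E k \<alpha>" "is_k_cut V E k C"
    and D: "D \<in> opt_cuts_of V E k \<beta>" "is_k_cut V E k D"
    using assms(6,7) opt_cuts_of_is_k_cut[OF assms(5)] unfolding optimal_cuts_def by blast
  have sub: "C \<subseteq> V" "D \<subseteq> V" "finite (edge_boundary V E C)" "finite (edge_boundary V E D)"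
    using C D by (auto simp: is_k_cut_def is_cut_def)
  have min: "C \<in> min_cuts_of V E \<alpha>" "D \<in> min_cuts_of V E \<beta>"
    using C D by (auto simp: opt_cuts_of_def)
  have sep: "C \<in> separators V E \<alpha>" "D \<in> separators V E \<beta>"
    using min cuts_of_subset_separators by (auto simp: min_cuts_of_def)
  have kcompl: "is_k_cut V E k (V - X)" if "is_k_cut V E k X" for X
    using that is_cut_compl[of V E X] by (auto simp: is_k_cut_def is_cut_def edge_boundary_compl)
  \<comment> \<open>Optimality and crossing survive complements, so any pair of opposite corners can
    be presented as the pair treated in the lemmas.\<close>
  have C': "V - C \<in> opt_cuts_of V E k \<alpha>" "is_k_cut V E k (V - C)" "V - (V - C) = C"
    and D': "V - D \<in> opt_cuts_of V E k \<beta>" "is_k_cut V E k (V - D)" "V - (V - D) = D"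
    using C D opt_cuts_of_compl kcompl sub by (auto simp: double_diff)
  have cross': "\<not> nested V C (V - D)" "\<not> nested V (V - C) D" "\<not> nested V (V - C) (V - D)"
    using cross sub by (auto simp: nested_compl nested_commute[of "V - C"] nested_commute[of C])
  let ?c1 = "C \<inter> D" and ?c2 = "C \<inter> (V - D)" and ?c3 = "(V - C) \<inter> D" and ?c4 = "(V - C) \<inter> (V - D)"
  have sub': "V - D \<subseteq> V" "finite (edge_boundary V E (V - D))" using sub by (auto simp: edge_boundary_compl)
  have finite_corners: "finite (edge_boundary V E X)" if "X \<in> {?c1, ?c2, ?c3, ?c4}" for X
    using that opposite_corners_boundary(1,2)[OF sub]
      opposite_corners_boundary(1,2)[OF sub(1) sub'(1) sub(3) sub'(2)] C'(3) D'(3) by auto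
  have sep_corner: "X \<in> separators V E \<gamma>"
    if "infinite (range \<gamma> \<inter> X)" "infinite (range \<gamma> \<inter> Y)" "X \<inter> Y = {}"
      "X \<in> {?c1, ?c2, ?c3, ?c4}" "Y \<in> {?c1, ?c2, ?c3, ?c4}" for X Y \<gamma>
  proof -
    have "X \<subseteq> V" "Y \<subseteq> V - X" using that sub by auto
    then have "infinite (range \<gamma> \<inter> (V - X))"
      using that(2) by (meson Int_mono infinite_super subset_refl)
    then show ?thesis
      using that finite_corners \<open>X \<subseteq> V\<close> by (auto simp: separators_def)
  qed
  have inf: "infinite (range \<gamma> \<inter> (X \<inter> Y)) \<or> infinite (range \<gamma> \<inter> (X \<inter> (V - Y)))"
    if "infinite (range \<gamma> \<inter> X)" "X \<subseteq> V" for \<gamma> X Y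
  proof -
    have "range \<gamma> \<inter> X = range \<gamma> \<inter> (X \<inter> Y) \<union> range \<gamma> \<inter> (X \<inter> (V - Y))" using that(2) by blast
    then show ?thesis using that(1) by (metis finite_Un)
  qed
  have inf_\<alpha>: "infinite (range \<alpha> \<inter> ?c1) \<or> infinite (range \<alpha> \<inter> ?c2)"
      "infinite (range \<alpha> \<inter> ?c3) \<or> infinite (range \<alpha> \<inter> ?c4)"
    using sep(1) inf[of \<alpha> C D] inf[of \<alpha> "V - C" D] by (simp_all add: separators_def)
  have inf_\<beta>: "infinite (range \<beta> \<inter> ?c1) \<or> infinite (range \<beta> \<inter> ?c3)"
      "infinite (range \<beta> \<inter> ?c2) \<or> infinite (range \<beta> \<inter> ?c4)"
    using sep(2) inf[of \<beta> D C] inf[of \<beta> "V - D" C]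
    by (simp_all add: separators_def Int_commute[of D] Int_commute[of "V - D"])
  \<comment> \<open>The listed pairs are the corners on different sides of \<open>C\<close> or on
    different sides of \<open>D\<close>; being disjoint, each supplies the infinite complement for
    the other.\<close>
  have sep_pair: "X \<in> separators V E \<gamma> \<and> Y \<in> separators V E \<gamma>"
    if "infinite (range \<gamma> \<inter> X)" "infinite (range \<gamma> \<inter> Y)"
      "(X, Y) \<in> {?c1, ?c2} \<times> {?c3, ?c4} \<union> {?c1, ?c3} \<times> {?c2, ?c4}" for X Y \<gamma>
  proof -
    have disj: "X \<inter> Y = {}" "Y \<inter> X = {}" using that(3) by auto
    have mem: "X \<in> {?c1, ?c2, ?c3, ?c4}" "Y \<in> {?c1, ?c2, ?c3, ?c4}" using that(3) by blast+
    show ?thesis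
      using sep_corner[OF that(1,2) disj(1) mem] sep_corner[OF that(2,1) disj(2) mem(2,1)] ..
  qed
  have "(?c1 \<in> separators V E \<alpha> \<or> ?c2 \<in> separators V E \<alpha>) \<and>
      (?c3 \<in> separators V E \<alpha> \<or> ?c4 \<in> separators V E \<alpha>)"
    using inf_\<alpha> by (elim disjE) (drule (1) sep_pair, simp, simp)+
  moreover have "(?c1 \<in> separators V E \<beta> \<or> ?c3 \<in> separators V E \<beta>) \<and>
      (?c2 \<in> separators V E \<beta> \<or> ?c4 \<in> separators V E \<beta>)"
    using inf_\<beta> by (elim disjE) (drule (1) sep_pair, simp, simp)+
  \<comment> \<open>This and the next three facts forbid a corner separating \<alpha> while the
    opposite one separates \<beta>. With the disjunctions above, only two cases survive: \<alpha> on
    one diagonal and \<beta> on the other. The last two facts exclude them.\<close>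
  moreover have "\<not> (?c1 \<in> separators V E \<alpha> \<and> ?c4 \<in> separators V E \<beta>)"
    using opposite_corners_not_separators[OF conn C D cross] by blast
  moreover have "\<not> (?c4 \<in> separators V E \<alpha> \<and> ?c1 \<in> separators V E \<beta>)"
    using opposite_corners_not_separators[OF conn C'(1,2) D'(1,2) cross'(3)] C'(3) D'(3) by auto
  moreover have "\<not> (?c2 \<in> separators V E \<alpha> \<and> ?c3 \<in> separators V E \<beta>)"
    using opposite_corners_not_separators[OF conn C D'(1,2) cross'(1)] D'(3) by auto
  moreover have "\<not> (?c3 \<in> separators V E \<alpha> \<and> ?c2 \<in> separators V E \<beta>)"
    using opposite_corners_not_separators[OF conn C'(1,2) D cross'(2)] C'(3) by auto
  moreover have "\<not> (?c1 \<in> separators V E \<alpha> \<and> ?c4 \<in> separators V E \<alpha> \<and>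
      ?c2 \<in> separators V E \<beta> \<and> ?c3 \<in> separators V E \<beta>)"
    using not_separated_by_both_diagonals[OF conn C D cross] by blast
  moreover have "\<not> (?c2 \<in> separators V E \<alpha> \<and> ?c3 \<in> separators V E \<alpha> \<and>
      ?c1 \<in> separators V E \<beta> \<and> ?c4 \<in> separators V E \<beta>)"
    using not_separated_by_both_diagonals[OF conn C D'(1,2) cross'(1)] D'(3) by auto
  ultimately show False by blast
qed

end
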